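(* Let $X\neq\{0\}$ be a real Hilbert space, let $m\in\{2,3,\ldots\}$, let $R\colon X\to X$ be a linear isometry with $R^m=\operatorname{Id}$, let $M:=\operatorname{Id}-R$, and let $\gamma>0$. Then $$J_{\gamma M}=\frac{1}{(1+\gamma)^m-\gamma^m}\sum_{k=0}^{m-1}(1+\gamma)^{m-1-k}\gamma^kR^k.$$
   Context: $\operatorname{Id}$ is the identity operator on $X$. A linear isometry satisfies $\|Rx\|=\|x\|$ for all $x\in X$. For a maximally monotone (possibly set-valued) operator $A$ on $X$, the resolvent is $J_A:=(\operatorname{Id}+A)^{-1}$, which is single-valued with full domain $X$; in particular $J_{\gamma M}=(\operatorname{Id}+\gamma M)^{-1}$. *)

theory Defs
  imports "HOL-Analysis.Inner_Product"
begin

text \<open>A set-valued operator on \<open>'a\<close> is a map \<open>'a \<Rightarrow> 'a set\<close>; an ordinary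
  (single-valued, everywhere defined) map is identified with its singleton-valued operator.\<close>

definition single_valued_op :: "('a \<Rightarrow> 'a) \<Rightarrow> 'a \<Rightarrow> 'a set" where
  "single_valued_op f = (\<lambda>x. {f x})"

definition op_plus :: "('a::plus \<Rightarrow> 'a set) \<Rightarrow> ('a \<Rightarrow> 'a set) \<Rightarrow> 'a \<Rightarrow> 'a set" where
  "op_plus A B = (\<lambda>x. {u + v | u v. u \<in> A x \<and> v \<in> B x})"

definition op_scale :: "real \<Rightarrow> ('a::real_vector \<Rightarrow> 'a set) \<Rightarrow> 'a \<Rightarrow> 'a set" where
  "op_scale c A = (\<lambda>x. {c *\<^sub>R u | u. u \<in> A x})"

definition op_inverse :: "('a \<Rightarrow> 'a set) \<Rightarrow> 'a \<Rightarrow> 'a set" where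
  "op_inverse A = (\<lambda>y. {x. y \<in> A x})"

text \<open>The resolvent \<open>(Id + A)\<^sup>-\<^sup>1\<close> is kept set-valued, so it makes sense for every \<open>A\<close>.
  An equation \<open>resolvent A = single_valued_op f\<close> therefore also asserts that the resolvent is
  single-valued with full domain.\<close>

definition resolvent :: "('a::real_vector \<Rightarrow> 'a set) \<Rightarrow> 'a \<Rightarrow> 'a set" where
  "resolvent A = op_inverse (op_plus (single_valued_op id) A)"

end

theory Submission
  imports Defs
begin

text \<open>The inclusion \<open>x \<in> (Id + \<gamma>M)\<^sup>-\<^sup>1 y\<close> is the linear equation \<open>(aId - bR) x = y\<close> with
  \<open>a = 1 + \<gamma>\<close> and \<open>b = \<gamma>\<close>.  The identity
  \<open>a\<^sup>m - b\<^sup>m = (a - b) (a\<^sup>m\<^sup>-\<^sup>1 + a\<^sup>m\<^sup>-\<^sup>2 b + \<dots> + b\<^sup>m\<^sup>-\<^sup>1)\<close> holds with \<open>aId\<close> and \<open>bR\<close> in place of \<open>a\<close> and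
  \<open>b\<close>, because \<open>aId\<close> and \<open>bR\<close> commute for linear \<open>R\<close> (\<open>linear_geometric_sum_telescope\<close>).  Since
  \<open>R\<^sup>m = Id\<close>, its left side is then the scalar \<open>a\<^sup>m - b\<^sup>m > 0\<close>, so the geometric sum divided by that
  scalar inverts \<open>aId - bR\<close>.  Being a left inverse makes the resolvent at most
  single-valued; being a right inverse, which follows since the sum commutes with \<open>R\<close>
  (\<open>linear_funpow_sum_commute\<close>), gives it full domain.\<close>

lemma linear_funpow:
  fixes R :: "'a::real_vector \<Rightarrow> 'a"
  assumes "linear R"
  shows "linear (R ^^ k)"
proof (induction k)
  case 0
  show ?case by (simp add: linear_iff)
next
  case (Suc k)
  then show ?case using linear_compose[OF Suc assms] by (simp only: funpow.simps)
qed

text \<open>Applying \<open>R\<^sup>k\<close> to \<open>ax - bRx\<close> turns the \<open>k\<close>-th term into the difference of two consecutive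
  values of \<open>a\<^sup>n\<^sup>-\<^sup>k b\<^sup>k R\<^sup>k x\<close>, so only the values at \<open>0\<close> and \<open>n\<close> survive.\<close>

lemma linear_geometric_sum_telescope:
  fixes R :: "'a::real_vector \<Rightarrow> 'a"
  assumes "linear R"
  shows "(\<Sum>k<n. (a ^ (n - 1 - k) * b ^ k) *\<^sub>R (R ^^ k) (a *\<^sub>R x - b *\<^sub>R R x))
    = a ^ n *\<^sub>R x - b ^ n *\<^sub>R (R ^^ n) x"
proof -
  let ?g = "\<lambda>k. (a ^ (n - k) * b ^ k) *\<^sub>R (R ^^ k) x"
  have "(a ^ (n - 1 - k) * b ^ k) *\<^sub>R (R ^^ k) (a *\<^sub>R x - b *\<^sub>R R x) = ?g k - ?g (Suc k)"
    if "k < n" for k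
  proof -
    have pow: "a ^ (n - k) = a * a ^ (n - 1 - k)"
      using that by (metis Suc_diff_Suc diff_Suc_eq_diff_pred power_Suc)
    have shift: "(R ^^ k) (a *\<^sub>R x - b *\<^sub>R R x) = a *\<^sub>R (R ^^ k) x - b *\<^sub>R (R ^^ Suc k) x"
      by (simp only: linear_diff[OF linear_funpow[OF assms]]
          linear_cmul[OF linear_funpow[OF assms]] funpow_simps_right o_apply)
    show ?thesis
      by (simp add: pow shift scaleR_diff_right mult_ac)
  qed
  then have "(\<Sum>k<n. (a ^ (n - 1 - k) * b ^ k) *\<^sub>R (R ^^ k) (a *\<^sub>R x - b *\<^sub>R R x))
      = (\<Sum>k<n. ?g k - ?g (Suc k))"
    by (intro sum.cong) auto
  also have "\<dots> = ?g 0 - ?g n"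
    by (rule sum_lessThan_telescope')
  finally show ?thesis by simp
qed

lemma linear_funpow_sum_commute:
  fixes R :: "'a::real_vector \<Rightarrow> 'a"
  assumes "linear R"
  shows "a *\<^sub>R (\<Sum>k\<in>K. c k *\<^sub>R (R ^^ k) y) - b *\<^sub>R R (\<Sum>k\<in>K. c k *\<^sub>R (R ^^ k) y)
    = (\<Sum>k\<in>K. c k *\<^sub>R (R ^^ k) (a *\<^sub>R y - b *\<^sub>R R y))"
proof -
  have "(R ^^ k) (a *\<^sub>R y - b *\<^sub>R R y) = a *\<^sub>R (R ^^ k) y - b *\<^sub>R R ((R ^^ k) y)" for k
    by (simp only: linear_diff[OF linear_funpow[OF assms]]
        linear_cmul[OF linear_funpow[OF assms]] funpow_swap1)
  then show ?thesis
    by (simp add: linear_sum[OF assms] linear_cmul[OF assms]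
        scaleR_sum_right scaleR_diff_right sum_subtractf mult.commute)
qed

lemma mem_resolvent_scaled_displacement_iff:
  fixes R :: "'a::real_vector \<Rightarrow> 'a"
  shows "x \<in> resolvent (op_scale \<gamma> (single_valued_op (\<lambda>x. x - R x))) y
    \<longleftrightarrow> (1 + \<gamma>) *\<^sub>R x - \<gamma> *\<^sub>R R x = y"
proof -
  have "x \<in> resolvent (op_scale \<gamma> (single_valued_op (\<lambda>x. x - R x))) y
      \<longleftrightarrow> y = x + \<gamma> *\<^sub>R (x - R x)"
    by (simp add: resolvent_def op_inverse_def op_plus_def op_scale_def single_valued_op_def)
  then show ?thesis
    by (auto simp: algebra_simps)
qed

theorem corollary2p2:
  fixes R M :: "'a::{real_inner, complete_space} \<Rightarrow> 'a"
    and m :: nat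
    and \<gamma> :: real
  assumes "(UNIV :: 'a set) \<noteq> {0}"
    and "m \<ge> 2"
    and "linear R"
    and "\<And>x. norm (R x) = norm x"
    and "R ^^ m = id"
    and "M = (\<lambda>x. x - R x)"
    and "\<gamma> > 0"
  shows "resolvent (op_scale \<gamma> (single_valued_op M)) =
    single_valued_op (\<lambda>x. (1 / ((1 + \<gamma>) ^ m - \<gamma> ^ m)) *\<^sub>R
      (\<Sum>k = 0..m - 1. ((1 + \<gamma>) ^ (m - 1 - k) * \<gamma> ^ k) *\<^sub>R (R ^^ k) x))"
proof -
  let ?d = "(1 + \<gamma>) ^ m - \<gamma> ^ m"
  let ?S = "\<lambda>x. \<Sum>k = 0..m - 1. ((1 + \<gamma>) ^ (m - 1 - k) * \<gamma> ^ k) *\<^sub>R (R ^^ k) x"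
  let ?L = "\<lambda>x. (1 + \<gamma>) *\<^sub>R x - \<gamma> *\<^sub>R R x"
  have "\<gamma> ^ m < (1 + \<gamma>) ^ m"
    using assms(2,7) by (intro power_strict_mono) auto
  then have d: "?d \<noteq> 0" by simp
  have "{0..m - 1} = {..<m}"
    using assms(2) by auto
  then have SL: "?S (?L x) = ?d *\<^sub>R x" for x
    using linear_geometric_sum_telescope[OF assms(3), of "1 + \<gamma>" m \<gamma> x] assms(5)
    by (simp add: scaleR_diff_left)
  have LS: "?L (?S y) = ?d *\<^sub>R y" for y
    using linear_funpow_sum_commute[OF assms(3)] SL by metis
  have "?L x = y \<longleftrightarrow> x = (1 / ?d) *\<^sub>R ?S y" for x y
  proof
    assume "?L x = y"
    then have "?S y = ?d *\<^sub>R x" using SL by blast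
    then show "x = (1 / ?d) *\<^sub>R ?S y" using d by simp
  next
    assume x: "x = (1 / ?d) *\<^sub>R ?S y"
    have "?L x = (1 / ?d) *\<^sub>R ?L (?S y)"
      unfolding x linear_cmul[OF assms(3)]
      by (simp only: scaleR_diff_right scaleR_left_commute)
    then show "?L x = y" using LS d by simp
  qed
  then show ?thesis
    unfolding assms(6)
    by (intro ext set_eqI, subst mem_resolvent_scaled_displacement_iff)
      (simp only: single_valued_op_def singleton_iff)
qed

end
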